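(* There exist infinitely many integers $n$ such that each of the five integers $n$, $n+1$, $n+2$, $n+4$, $n+5$ can be written in the form $a^2+b^2$ with $a,b$ nonzero integers. *)

theory Defs
  imports Complex_Main
begin

definition sum_two_nonzero_squares :: "int \<Rightarrow> bool" where
  "sum_two_nonzero_squares m \<longleftrightarrow> (\<exists>a b :: int. a \<noteq> 0 \<and> b \<noteq> 0 \<and> m = a\<^sup>2 + b\<^sup>2)"

end

theory Submission
  imports Defs
begin

text \<open>
  Take \<open>n = x\<^sup>2\<close>, so that \<open>n + 1\<close> and \<open>n + 4\<close> need no attention. If \<open>2 x + 1 = (5 f)\<^sup>2\<close>, then
  \<open>x\<^sup>2 + 2 = (x - 1)\<^sup>2 + (5 f)\<^sup>2\<close>; if \<open>10 x - 20 = (10 g)\<^sup>2\<close>, then \<open>x\<^sup>2 + 5 = (x - 5)\<^sup>2 + (10 g)\<^sup>2\<close>.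
  Both hold for \<open>x = 10 g\<^sup>2 + 2\<close> as soon as \<open>4 g\<^sup>2 + 1 = 5 f\<^sup>2\<close>, a Pell equation. The solution
  \<open>(g, f) = (341, 305)\<close> has \<open>109 dvd x\<close>, and since \<open>109 = 10\<^sup>2 + 3\<^sup>2\<close> this makes \<open>x\<^sup>2\<close> a sum of two
  nonzero squares. Multiplication by \<open>(9 + 4 \<surd>5)\<^sup>9 = 96450076809 + 43133785636 \<surd>5\<close>, which is
  \<open>-1\<close> modulo \<open>109\<close>, preserves that divisibility and yields infinitely many solutions.
\<close>

lemma five_sums_of_two_nonzero_squares:
  fixes f g :: int
  assumes pell: "4 * g\<^sup>2 + 1 = 5 * f\<^sup>2" and dvd: "109 dvd 5 * g\<^sup>2 + 1" and g: "g \<noteq> 0"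
    and n: "n = (10 * g\<^sup>2 + 2)\<^sup>2"
  shows "sum_two_nonzero_squares n \<and> sum_two_nonzero_squares (n + 1) \<and>
    sum_two_nonzero_squares (n + 2) \<and> sum_two_nonzero_squares (n + 4) \<and>
    sum_two_nonzero_squares (n + 5)"
proof -
  define x where "x = 10 * g\<^sup>2 + 2"
  have x: "x > 0" unfolding x_def by (simp add: add_nonneg_pos)
  obtain h where h: "5 * g\<^sup>2 + 1 = 109 * h" using dvd by (auto elim: dvdE)
  have xh: "x = 109 * (2 * h)" unfolding x_def using h by linarith
  have f: "f \<noteq> 0"
  proof
    assume "f = 0"
    with pell have "4 * g\<^sup>2 + 1 = 0" by simp
    then show False by presburger
  qed
  \<comment> \<open>Since \<open>x\<close> is 2 modulo 10, it is neither 1 nor 5.\<close>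
  have x1: "x - 1 \<noteq> 0" unfolding x_def by presburger
  have x5: "x - 5 \<noteq> 0" unfolding x_def by presburger
  have nx: "n = x\<^sup>2" using n by (simp add: x_def)
  \<comment> \<open>(10 + 3i)^2 = 91 + 60i, hence 91^2 + 60^2 = 109^2.\<close>
  have "n = (91 * (2 * h))\<^sup>2 + (60 * (2 * h))\<^sup>2"
    unfolding nx xh by (simp add: power2_eq_square)
  moreover have "h \<noteq> 0" using x xh by auto
  ultimately have "sum_two_nonzero_squares n"
    unfolding sum_two_nonzero_squares_def
    by (intro exI[of _ "91 * (2 * h)"] exI[of _ "60 * (2 * h)"]) simp
  moreover have "sum_two_nonzero_squares (n + 1)"
    unfolding sum_two_nonzero_squares_def using x nx
    by (intro exI[of _ x] exI[of _ 1]) simp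
  moreover have "sum_two_nonzero_squares (n + 2)"
  proof -
    have "(5 * f)\<^sup>2 = 2 * x + 1" using pell by (simp add: x_def power_mult_distrib)
    then have "n + 2 = (x - 1)\<^sup>2 + (5 * f)\<^sup>2"
      unfolding nx by (simp add: power2_eq_square algebra_simps)
    then show ?thesis unfolding sum_two_nonzero_squares_def
      using x1 f by (intro exI[of _ "x - 1"] exI[of _ "5 * f"]) simp
  qed
  moreover have "sum_two_nonzero_squares (n + 4)"
    unfolding sum_two_nonzero_squares_def using x nx
    by (intro exI[of _ x] exI[of _ 2]) simp
  moreover have "sum_two_nonzero_squares (n + 5)"
  proof -
    have "(10 * g)\<^sup>2 = 10 * x - 20" by (simp add: x_def power_mult_distrib)
    then have "n + 5 = (x - 5)\<^sup>2 + (10 * g)\<^sup>2"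
      unfolding nx by (simp add: power2_eq_square algebra_simps)
    then show ?thesis unfolding sum_two_nonzero_squares_def
      using x5 g by (intro exI[of _ "x - 5"] exI[of _ "10 * g"]) simp
  qed
  ultimately show ?thesis by blast
qed

lemma pell_solutions_unbounded:
  "\<exists>f g :: int. 4 * g\<^sup>2 + 1 = 5 * f\<^sup>2 \<and> 109 dvd 5 * g\<^sup>2 + 1 \<and> f > 0 \<and> g > int k"
proof (induction k)
  case 0
  show ?case by (intro exI[of _ 305] exI[of _ 341]) simp
next
  case (Suc k)
  then obtain f g :: int where pell: "4 * g\<^sup>2 + 1 = 5 * f\<^sup>2" and dvd: "109 dvd 5 * g\<^sup>2 + 1"
    and f: "f > 0" and g: "g > int k" by blast
  \<comment> \<open>\<open>2 * g' + f' * sqrt 5\<close> is \<open>2 * g + f * sqrt 5\<close>, of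
    norm -1, times the ninth power of the unit 9 + 4 \<open>sqrt 5\<close>.\<close>
  define g' where "g' = 96450076809 * g + 107834464090 * f"
  define f' where "f' = 86267571272 * g + 96450076809 * f"
  have "4 * g'\<^sup>2 + 1 = 5 * f'\<^sup>2"
    using pell unfolding g'_def f'_def by (simp add: power2_eq_square algebra_simps)
  moreover have "109 dvd 5 * g'\<^sup>2 + 1"
  proof -
    \<comment> \<open>The quotient \<open>(g' + g) / 109\<close>: modulo 109 the step only negates
      \<open>g\<close>, so \<open>g\<^sup>2\<close> is kept.\<close>
    define t where "t = 884863090 * g + 989307010 * f"
    have g': "g' = 109 * t - g" unfolding g'_def t_def by simp
    have "5 * g'\<^sup>2 + 1 = 109 * (5 * (109 * t\<^sup>2 - 2 * t * g)) + (5 * g\<^sup>2 + 1)"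
      unfolding g' by (simp add: power2_eq_square algebra_simps)
    then show ?thesis using dvd by (metis dvd_add dvd_triv_left)
  qed
  moreover have "f' > 0" "g' > int (Suc k)"
    using f g unfolding f'_def g'_def by simp_all
  ultimately show ?case by blast
qed

theorem theorem3p3:
  shows "infinite {n :: int.
    sum_two_nonzero_squares n \<and>
    sum_two_nonzero_squares (n + 1) \<and>
    sum_two_nonzero_squares (n + 2) \<and>
    sum_two_nonzero_squares (n + 4) \<and>
    sum_two_nonzero_squares (n + 5)}" (is "infinite ?S")
proof
  assume fin: "finite ?S"
  \<comment> \<open>\<open>nat\<close> cuts a negative maximum off at 0, so \<open>g\<close> is also
    positive.\<close>
  obtain f g :: int where pell: "4 * g\<^sup>2 + 1 = 5 * f\<^sup>2" and dvd: "109 dvd 5 * g\<^sup>2 + 1"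
    and g: "g > int (nat (Max ?S))"
    using pell_solutions_unbounded by blast
  define n where "n = (10 * g\<^sup>2 + 2)\<^sup>2"
  have "n \<in> ?S"
    using five_sums_of_two_nonzero_squares[OF pell dvd _ n_def] g by simp
  then have "n \<le> Max ?S" using fin by (rule Max_ge[rotated])
  moreover have "g \<le> g\<^sup>2" using g by (intro self_le_power) linarith+
  moreover have "10 * g\<^sup>2 + 2 \<le> n"
    unfolding n_def by (intro self_le_power) (simp_all add: add_nonneg_pos)
  ultimately show False using g by linarith
qed

end
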